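(* Let $k\ge2$ and define $\Omega_k\colon W_{k-1}\to T_k$ by $\Omega_k((x_{ij},y_{ij},z_{ij}))=(a_{ij})$, where $a_{0j}=\sum_{l=j}^{k-1}(x_{1l}+y_{1l})$ for $1\le j<k$, $a_{0k}=0$; $a_{ij}=y_{i\,j-1}$ for $1\le i<j\le k$; $a_{jj}=\sum_{l=j}^{k-1}z_{ll}$ for $1\le j<k$, $a_{kk}=0$ (and $a_{00}=0$). Then $\Omega_k$ maps $\mathsf{BZ}_{k-1}$ injectively into $\mathsf{LR}_k$, and maps $\mathsf{BZ}_{k-1}(\lambda,\mu,\nu)$ bijectively onto $\mathsf{LR}_k(\lambda,\mu,\nu)$ for any $\lambda,\mu,\nu\in\mathsf{D}_k$ with $\mu_k=0$ and $\nu_k=0$.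
   Context: $T_k$ is the vector space of arrays $A=(a_{ij})_{0\le i\le j\le k}$ of real numbers with $a_{00}=0$. $\mathsf{D}_k$ is the set of real $k$-tuples $\lambda_1\ge\cdots\ge\lambda_k$. Littlewood-Richardson triangles: $A\in T_k$ with (P) $a_{ij}\ge0$ for $1\le i<j\le k$; (CS) $\sum_{p=0}^{i-1}a_{pj}\ge\sum_{p=0}^{i}a_{p\,j+1}$ for $1\le i\le j<k$; (LR) $\sum_{q=i}^{j}a_{iq}\ge\sum_{q=i+1}^{j+1}a_{i+1\,q}$ for $1\le i\le j<k$. $\mathsf{LR}_k$ is the cone of these; the type of $A$ is $(\lambda,\mu,\nu)$ with $\mu_j=a_{0j}$, $\lambda_j=\sum_{p=0}^{j}a_{pj}$, $\nu_i=\sum_{q=i}^{k}a_{iq}$ ($1\le i,j\le k$), and $\mathsf{LR}_k(\lambda,\mu,\nu)$ is the set of those of type $(\lambda,\mu,\nu)$. For $m\ge1$, $V_m$ is the space of real labelings $X=(x_{ij},y_{ij},z_{ij})_{1\le i\le j\le m}$, and $W_m\subseteq V_m$ is the subspace defined by, for all $1\le i\le j<m$: (BZ1) $y_{ij}+z_{ij}=y_{i+1\,j+1}+z_{i\,j+1}$; (BZ2) $x_{i\,j+1}+y_{ij}=x_{i+1\,j+1}+y_{i+1\,j+1}$; (BZ3) $x_{i\,j+1}+z_{i\,j+1}=x_{i+1\,j+1}+z_{ij}$. A Berenstein-Zelevinsky triangle of size $m$ is an element of $W_m$ with all entries nonnegative; $\mathsf{BZ}_m$ is the cone of these. For $\lambda,\mu,\nu\in\mathsf{D}_{m+1}$,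 such a triangle has type $(\lambda,\mu,\nu)$ if $x_{1j}+y_{1j}=\mu_j-\mu_{j+1}$, $x_{jj}+z_{jj}=\lambda_j-\lambda_{j+1}$ for $1\le j\le m$, and $y_{im}+z_{im}=\nu_i-\nu_{i+1}$ for $1\le i\le m$; $\mathsf{BZ}_m(\lambda,\mu,\nu)$ is the set of those of type $(\lambda,\mu,\nu)$.
   Formalization: The bijection is stated only for λ, μ, ν with |λ| = |μ| + |ν|; without this it fails (k=2, λ=(1,1), μ=ν=(0,0): BZ_1(λ,μ,ν)={0} but LR_2(λ,μ,ν) is empty), and LR_k(λ,μ,ν) is always empty when the size condition fails. *)

theory Defs
  imports Complex_Main
begin

text \<open>
  Triangular arrays and tuples are functions on \<^typ>\<open>nat\<close> that vanish outside the index range,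
  so that two of them are equal exactly when all their entries agree.
\<close>

definition tri_space :: "nat \<Rightarrow> (nat \<Rightarrow> nat \<Rightarrow> real) set" where
  "tri_space k = {a. a 0 0 = 0 \<and> (\<forall>i j. \<not> (i \<le> j \<and> j \<le> k) \<longrightarrow> a i j = 0)}"

definition dom_weights :: "nat \<Rightarrow> (nat \<Rightarrow> real) set" where
  "dom_weights k = {l. (\<forall>i. i \<notin> {1..k} \<longrightarrow> l i = 0) \<and> (\<forall>i. 1 \<le> i \<and> i < k \<longrightarrow> l (i + 1) \<le> l i)}"

definition LR_cone :: "nat \<Rightarrow> (nat \<Rightarrow> nat \<Rightarrow> real) set" where
  "LR_cone k = {a \<in> tri_space k.
     (\<forall>i j. 1 \<le> i \<and> i < j \<and> j \<le> k \<longrightarrow> a i j \<ge> 0) \<and>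
     (\<forall>i j. 1 \<le> i \<and> i \<le> j \<and> j < k \<longrightarrow> (\<Sum>p=0..i-1. a p j) \<ge> (\<Sum>p=0..i. a p (j+1))) \<and>
     (\<forall>i j. 1 \<le> i \<and> i \<le> j \<and> j < k \<longrightarrow> (\<Sum>q=i..j. a i q) \<ge> (\<Sum>q=i+1..j+1. a (i+1) q))}"

definition LR_of_type ::
    "nat \<Rightarrow> (nat \<Rightarrow> real) \<Rightarrow> (nat \<Rightarrow> real) \<Rightarrow> (nat \<Rightarrow> real) \<Rightarrow> (nat \<Rightarrow> nat \<Rightarrow> real) set" where
  "LR_of_type k lam mu nu = {a \<in> LR_cone k.
     (\<forall>j\<in>{1..k}. mu j = a 0 j) \<and>
     (\<forall>j\<in>{1..k}. lam j = (\<Sum>p=0..j. a p j)) \<and>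
     (\<forall>i\<in>{1..k}. nu i = (\<Sum>q=i..k. a i q))}"

type_synonym labeling = "(nat \<Rightarrow> nat \<Rightarrow> real) \<times> (nat \<Rightarrow> nat \<Rightarrow> real) \<times> (nat \<Rightarrow> nat \<Rightarrow> real)"

definition label_space :: "nat \<Rightarrow> labeling set" where
  "label_space m = {(x, y, z). \<forall>i j. \<not> (1 \<le> i \<and> i \<le> j \<and> j \<le> m) \<longrightarrow> x i j = 0 \<and> y i j = 0 \<and> z i j = 0}"

definition BZ_space :: "nat \<Rightarrow> labeling set" where
  "BZ_space m = {(x, y, z). (x, y, z) \<in> label_space m \<and>
     (\<forall>i j. 1 \<le> i \<and> i \<le> j \<and> j < m \<longrightarrow>
        y i j + z i j = y (i+1) (j+1) + z i (j+1) \<and>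
        x i (j+1) + y i j = x (i+1) (j+1) + y (i+1) (j+1) \<and>
        x i (j+1) + z i (j+1) = x (i+1) (j+1) + z i j)}"

definition BZ_cone :: "nat \<Rightarrow> labeling set" where
  "BZ_cone m = {(x, y, z). (x, y, z) \<in> BZ_space m \<and>
     (\<forall>i j. 1 \<le> i \<and> i \<le> j \<and> j \<le> m \<longrightarrow> x i j \<ge> 0 \<and> y i j \<ge> 0 \<and> z i j \<ge> 0)}"

definition BZ_of_type ::
    "nat \<Rightarrow> (nat \<Rightarrow> real) \<Rightarrow> (nat \<Rightarrow> real) \<Rightarrow> (nat \<Rightarrow> real) \<Rightarrow> labeling set" where
  "BZ_of_type m lam mu nu = {(x, y, z). (x, y, z) \<in> BZ_cone m \<and>
     (\<forall>j\<in>{1..m}. x 1 j + y 1 j = mu j - mu (j+1)) \<and>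
     (\<forall>j\<in>{1..m}. x j j + z j j = lam j - lam (j+1)) \<and>
     (\<forall>i\<in>{1..m}. y i m + z i m = nu i - nu (i+1))}"

definition Omega :: "nat \<Rightarrow> labeling \<Rightarrow> nat \<Rightarrow> nat \<Rightarrow> real" where
  "Omega k = (\<lambda>(x, y, z) i j.
     if i = 0 \<and> 1 \<le> j \<and> j < k then \<Sum>l=j..k-1. x 1 l + y 1 l
     else if 1 \<le> i \<and> i < j \<and> j \<le> k then y i (j-1)
     else if i = j \<and> 1 \<le> j \<and> j < k then \<Sum>l=j..k-1. z l l
     else 0)"

end

theory Submission
  imports Defs
begin

text \<open>
  On \<open>W\<^sub>k\<^sub>-\<^sub>1\<close> the slacks of the inequalities (CS) and (LR) of the image triangle are exactly the entries
  \<open>x\<^sub>i\<^sub>j\<close> and \<open>z\<^sub>i\<^sub>j\<close>, while (P) records the entries \<open>y\<^sub>i\<^sub>j\<close>. Reading off these slacks therefore inverts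
  \<open>\<Omega>\<^sub>k\<close> on the triangles with \<open>a\<^sub>0\<^sub>k = a\<^sub>k\<^sub>k = 0\<close> and identifies the two cones there. The type of a
  Berenstein-Zelevinsky triangle only prescribes consecutive differences of \<open>\<lambda>, \<mu>, \<nu>\<close>; the constants
  are recovered from \<open>\<mu>\<^sub>k = \<nu>\<^sub>k = 0\<close> and, for \<open>\<lambda>\<close>, from \<open>|\<lambda>| = |\<mu>| + |\<nu>|\<close>.
\<close>

section \<open>The slack labeling and its recursions\<close>

definition slacks :: "nat \<Rightarrow> (nat \<Rightarrow> nat \<Rightarrow> real) \<Rightarrow> labeling" where
  "slacks k a =
     ((\<lambda>i j. if 1 \<le> i \<and> i \<le> j \<and> j < k then (\<Sum>p=0..i-1. a p j) - (\<Sum>p=0..i. a p (j+1)) else 0),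
      (\<lambda>i j. if 1 \<le> i \<and> i \<le> j \<and> j < k then a i (j+1) else 0),
      (\<lambda>i j. if 1 \<le> i \<and> i \<le> j \<and> j < k then (\<Sum>q=i..j. a i q) - (\<Sum>q=i+1..j+1. a (i+1) q) else 0))"

lemma slacks_entries:
  assumes "slacks k a = (x, y, z)" "1 \<le> i" "i \<le> j" "j < k"
  shows "x i j = (\<Sum>p=0..i-1. a p j) - (\<Sum>p=0..i. a p (j+1))"
    and "y i j = a i (j+1)"
    and "z i j = (\<Sum>q=i..j. a i q) - (\<Sum>q=i+1..j+1. a (i+1) q)"
  using assms by (auto simp: slacks_def simp del: sum.cl_ivl_Suc)

text \<open>For a triangle of type (lam, mu, nu) these two conditions say mu_k = 0 and nu_k = 0,
  since nu_k is the one-term sum \<open>a k k\<close>.\<close>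

definition tri_space0 :: "nat \<Rightarrow> (nat \<Rightarrow> nat \<Rightarrow> real) set" where
  "tri_space0 k = {a \<in> tri_space k. a 0 k = 0 \<and> a k k = 0}"

text \<open>Raising i extends both sums by one entry. In column j+1 this is (BZ2) for the slacks. At
  i = 0 truncated subtraction would break it.\<close>

lemma CS_slack_Suc:
  fixes a :: "nat \<Rightarrow> nat \<Rightarrow> real"
  assumes "1 \<le> i"
  shows "(\<Sum>p=0..Suc i-1. a p j) - (\<Sum>p=0..Suc i. a p (j+1))
    = (\<Sum>p=0..i-1. a p j) - (\<Sum>p=0..i. a p (j+1)) + a i j - a (Suc i) (j+1)"
  using assms by (cases i) simp_all

text \<open>Raising j extends both sums by one entry; this is (BZ1) for the slacks.\<close>

lemma LR_slack_Suc:
  fixes a :: "nat \<Rightarrow> nat \<Rightarrow> real"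
  assumes "i \<le> j"
  shows "(\<Sum>q=i..Suc j. a i q) - (\<Sum>q=i+1..Suc j+1. a (i+1) q)
    = (\<Sum>q=i..j. a i q) - (\<Sum>q=i+1..j+1. a (i+1) q) + a i (Suc j) - a (i+1) (Suc j+1)"
  using assms by simp

section \<open>Tuples and their differences, double counting\<close>

lemma sum_differences:
  fixes f :: "nat \<Rightarrow> real"
  assumes "j \<le> n"
  shows "(\<Sum>l=j..n. f l - f (Suc l)) = f j - f (Suc n)"
  using sum_Suc_diff[of j n "\<lambda>l. - f l"] assms by (simp add: algebra_simps)

text \<open>Downward induction from the common last entry: each difference carries equality from n+1
  to n.\<close>

lemma eq_iff_differences_eq:
  fixes f g :: "nat \<Rightarrow> real"
  assumes last: "f k = g k"
  shows "(\<forall>j\<in>{1..k}. f j = g j) \<longleftrightarrow> (\<forall>j\<in>{1..k-1}. f j - f (j+1) = g j - g (j+1))"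
    (is "?L \<longleftrightarrow> ?R")
proof
  assume R: ?R
  show ?L
  proof
    fix j assume "j \<in> {1..k}"
    then have "j \<le> k" "1 \<le> j" by simp_all
    then show "f j = g j"
    proof (induction rule: inc_induct)
      case (step n)
      then have "n \<in> {1..k-1}" by auto
      then have "f n - f (n+1) = g n - g (n+1)" using R by blast
      then show ?case using step by simp
    qed (rule last)
  qed
qed auto

text \<open>Equal differences leave one additive constant c, and equal sums force k * c = 0. This
  serves \<open>lam\<close>, whose last entry is not prescribed.\<close>

lemma eq_iff_differences_eq_sum_eq:
  fixes f g :: "nat \<Rightarrow> real"
  assumes sum: "(\<Sum>j=1..k. f j) = (\<Sum>j=1..k. g j)"
  shows "(\<forall>j\<in>{1..k}. f j = g j) \<longleftrightarrow> (\<forall>j\<in>{1..k-1}. f j - f (j+1) = g j - g (j+1))"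
    (is "?L \<longleftrightarrow> ?R")
proof
  assume R: ?R
  define c where "c = f k - g k"
  \<comment> \<open>The shifted tuple \<open>g j + c\<close> agrees with \<open>f\<close> at k and
    has the differences of \<open>g\<close>.\<close>
  have shift: "\<forall>j\<in>{1..k}. f j = g j + c"
    using R by (subst eq_iff_differences_eq) (auto simp: c_def)
  then have "(\<Sum>j=1..k. f j) = (\<Sum>j=1..k. g j + c)"
    by (intro sum.cong) auto
  then have "real k * c = 0"
    using sum by (simp add: sum.distrib)
  then show ?L using shift by auto
qed auto

text \<open>Double counting by columns and by rows: entries with i > j vanish, so the inner ranges
  may be extended to 1..k and the sums swapped. For the type of \<open>a\<close> this reads |lam| =
  |mu| + |nu|.\<close>

lemma tri_space_col_sums:
  assumes "a \<in> tri_space k"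
  shows "(\<Sum>j=1..k. \<Sum>p=0..j. a p j) = (\<Sum>j=1..k. a 0 j) + (\<Sum>i=1..k. \<Sum>q=i..k. a i q)"
proof -
  have zero: "a i j = 0" if "j < i" for i j
    using assms that by (auto simp: tri_space_def)
  have "(\<Sum>j=1..k. \<Sum>p=0..j. a p j) = (\<Sum>j=1..k. a 0 j + (\<Sum>p=1..k. a p j))"
  proof (intro sum.cong refl)
    fix j assume "j \<in> {1..k}"
    then have "(\<Sum>p=1..j. a p j) = (\<Sum>p=1..k. a p j)"
      by (intro sum.mono_neutral_left) (auto intro: zero)
    then show "(\<Sum>p=0..j. a p j) = a 0 j + (\<Sum>p=1..k. a p j)"
      by (simp add: sum.atLeast_Suc_atMost)
  qed
  also have "\<dots> = (\<Sum>j=1..k. a 0 j) + (\<Sum>i=1..k. \<Sum>q=1..k. a i q)"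
    by (simp add: sum.distrib sum.swap[of "\<lambda>j p. a p j"])
  also have "(\<Sum>i=1..k. \<Sum>q=1..k. a i q) = (\<Sum>i=1..k. \<Sum>q=i..k. a i q)"
    by (intro sum.cong refl sum.mono_neutral_right) (auto intro: zero)
  finally show ?thesis .
qed

section \<open>Omega and the slack map as mutual inverses\<close>

lemma Omega_in_tri_space0: "Omega k X \<in> tri_space0 k"
  by (cases X) (auto simp: Omega_def tri_space0_def tri_space_def)

text \<open>Induction down column j: at i = 1 the tail sum in row 0 loses its first term, and each
  further step is (BZ2).\<close>

lemma CS_slack_Omega:
  assumes X: "(x, y, z) \<in> BZ_space (k - 1)" and "1 \<le> i" "i \<le> j" "j < k"
  shows "(\<Sum>p=0..i-1. Omega k (x, y, z) p j) - (\<Sum>p=0..i. Omega k (x, y, z) p (j+1)) = x i j"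
  using \<open>1 \<le> i\<close> \<open>i \<le> j\<close>
proof (induction i rule: dec_induct)
  case base
  have "(\<Sum>l=j..k-1. x 1 l + y 1 l) = x 1 j + y 1 j + (\<Sum>l=j+1..k-1. x 1 l + y 1 l)"
    using \<open>j < k\<close> by (simp add: sum.atLeast_Suc_atMost)
  \<comment> \<open>For j = k-1 the remaining sum is empty, matching the entry 0 at (0, k).\<close>
  then have "Omega k (x, y, z) 0 j = x 1 j + y 1 j + Omega k (x, y, z) 0 (j+1)"
    using base \<open>j < k\<close> by (simp add: Omega_def)
  moreover have "Omega k (x, y, z) 1 (j+1) = y 1 j"
    using base \<open>j < k\<close> by (simp add: Omega_def)
  ultimately show ?case by simp
next
  case (step n)
  \<comment> \<open>\<open>Omega\<close> moves y one column to the right, so (BZ2) is used at column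
    j-1.\<close>
  obtain l where l: "j = Suc l" using step by (cases j) auto
  have "x n (l+1) + y n l = x (n+1) (l+1) + y (n+1) (l+1)"
    using X step \<open>j < k\<close> l by (simp add: BZ_space_def)
  moreover have "Omega k (x, y, z) n j = y n l" "Omega k (x, y, z) (Suc n) (j+1) = y (n+1) (l+1)"
    using step \<open>j < k\<close> l by (simp_all add: Omega_def)
  ultimately show ?case
    using step l CS_slack_Suc[of n "Omega k (x, y, z)" j] by simp
qed

text \<open>Induction along row i from the diagonal, where consecutive tail sums differ by
  \<open>z i i\<close>; each further step is (BZ1).\<close>

lemma LR_slack_Omega:
  assumes X: "(x, y, z) \<in> BZ_space (k - 1)" and "1 \<le> i" "i \<le> j" "j < k"
  shows "(\<Sum>q=i..j. Omega k (x, y, z) i q) - (\<Sum>q=i+1..j+1. Omega k (x, y, z) (i+1) q) = z i j"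
  using \<open>i \<le> j\<close> \<open>j < k\<close>
proof (induction j rule: dec_induct)
  case base
  have "(\<Sum>l=i..k-1. z l l) = z i i + (\<Sum>l=i+1..k-1. z l l)"
    using base by (simp add: sum.atLeast_Suc_atMost)
  \<comment> \<open>For i = k-1 the empty tail matches the entry 0 at (k, k).\<close>
  moreover have "(\<Sum>l=i+1..k-1. z l l) = 0" if "\<not> i + 1 < k"
    using that by simp
  ultimately show ?case
    using base \<open>1 \<le> i\<close> by (auto simp: Omega_def)
next
  case (step n)
  have "y i n + z i n = y (i+1) (n+1) + z i (n+1)"
    using X step \<open>1 \<le> i\<close> by (simp add: BZ_space_def)
  moreover have "Omega k (x, y, z) i (Suc n) = y i n"
      "Omega k (x, y, z) (i+1) (Suc n+1) = y (i+1) (n+1)"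
    using step \<open>1 \<le> i\<close> by (simp_all add: Omega_def)
  ultimately show ?case
    using step LR_slack_Suc[of i n "Omega k (x, y, z)"] by simp
qed

lemma slacks_Omega:
  assumes "X \<in> BZ_space (k - 1)"
  shows "slacks k (Omega k X) = X"
proof -
  obtain x y z where X: "X = (x, y, z)" by (cases X)
  have out: "x i j = 0 \<and> y i j = 0 \<and> z i j = 0" if "\<not> (1 \<le> i \<and> i \<le> j \<and> j < k)" for i j
  proof -
    have "\<not> (1 \<le> i \<and> i \<le> j \<and> j \<le> k - 1)" using that by linarith
    then show ?thesis
      using assms unfolding X BZ_space_def label_space_def by blast
  qed
  have "Omega k (x, y, z) i (j+1) = y i j" if "1 \<le> i" "i \<le> j" "j < k" for i j
    using that by (simp add: Omega_def)
  then show ?thesis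
    using CS_slack_Omega[OF assms[unfolded X]] LR_slack_Omega[OF assms[unfolded X]] out
    unfolding X slacks_def prod.inject by (intro conjI ext) (simp_all del: sum.cl_ivl_Suc)
qed

text \<open>On row 0 and on the diagonal the sums telescope to a_0j - a_0k and a_jj - a_kk;
  membership in \<open>tri_space0\<close> removes the boundary terms.\<close>

lemma Omega_slacks:
  assumes "a \<in> tri_space0 k"
  shows "Omega k (slacks k a) = a"
proof (intro ext)
  fix i j
  have a: "a 0 0 = 0" "a 0 k = 0" "a k k = 0" "\<And>i j. \<not> (i \<le> j \<and> j \<le> k) \<Longrightarrow> a i j = 0"
    using assms by (auto simp: tri_space0_def tri_space_def)
  consider "i = 0" "1 \<le> j" "j < k" | "1 \<le> i" "i < j" "j \<le> k" | "i = j" "1 \<le> j" "j < k"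
    | "\<not> (i = 0 \<and> 1 \<le> j \<and> j < k)" "\<not> (1 \<le> i \<and> i < j \<and> j \<le> k)" "\<not> (i = j \<and> 1 \<le> j \<and> j < k)"
    by blast
  then show "Omega k (slacks k a) i j = a i j"
  proof cases
    case 1
    \<comment> \<open>In \<open>x 1 l + y 1 l\<close> the entry \<open>a 1 (l+1)\<close>
      cancels.\<close>
    have "Omega k (slacks k a) i j = (\<Sum>l=j..k-1. a 0 l - a 0 (Suc l))"
      using 1 by (auto simp: Omega_def slacks_def intro!: sum.cong)
    also have "\<dots> = a 0 j"
      using 1 a sum_differences[of j "k-1" "a 0"] by simp
    finally show ?thesis using 1 by simp
  next
    case 2
    then show ?thesis by (auto simp: Omega_def slacks_def)
  next
    case 3
    have "Omega k (slacks k a) i j = (\<Sum>l=j..k-1. a l l - a (Suc l) (Suc l))"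
      using 3 by (auto simp: Omega_def slacks_def intro!: sum.cong)
    also have "\<dots> = a j j"
      using 3 a sum_differences[of j "k-1" "\<lambda>l. a l l"] by simp
    finally show ?thesis using 3 by simp
  next
    case 4
    \<comment> \<open>What remains are the corners (0,0), (0,k), (k,k) and positions outside the
      triangle.\<close>
    then have "a i j = 0"
      using a by (cases "i = 0"; cases "j = k"; cases "i \<le> j"; cases "j \<le> k"; cases "i = j") auto
    moreover have "Omega k (x, y, z) i j = 0" for x y z
      using 4 by (simp only: Omega_def prod.case if_False)
    ultimately show ?thesis by (metis prod_cases3)
  qed
qed

text \<open>The relations defining W are identities between slacks, valid for every array: (BZ1) and
  (BZ2) are the two slack recursions.\<close>

lemma slacks_in_BZ_space: "slacks k a \<in> BZ_space (k - 1)"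
proof -
  obtain x y z where X: "slacks k a = (x, y, z)" by (cases "slacks k a")
  note xyz = slacks_entries[OF X]
  have "(x, y, z) \<in> label_space (k - 1)"
    using X by (auto simp: label_space_def slacks_def)
  moreover have BZ1: "y i j + z i j = y (i+1) (j+1) + z i (j+1)"
    if "1 \<le> i" "i \<le> j" "j < k - 1" for i j
    using that LR_slack_Suc[of i j a] by (simp add: xyz del: sum.cl_ivl_Suc)
  moreover have BZ2: "x i (j+1) + y i j = x (i+1) (j+1) + y (i+1) (j+1)"
    if "1 \<le> i" "i \<le> j" "j < k - 1" for i j
    using that CS_slack_Suc[of i a "j+1"] by (simp add: xyz del: sum.cl_ivl_Suc)
  \<comment> \<open>Eliminating \<open>y i j - y (i+1) (j+1)\<close> from (BZ1) and (BZ2) gives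
    (BZ3).\<close>
  moreover have "x i (j+1) + z i (j+1) = x (i+1) (j+1) + z i j"
    if "1 \<le> i" "i \<le> j" "j < k - 1" for i j
    using BZ1[OF that] BZ2[OF that] by simp
  ultimately show ?thesis
    unfolding X BZ_space_def by blast
qed

section \<open>Matching the cones and the types\<close>

lemma slacks_in_BZ_cone_iff:
  assumes "a \<in> tri_space k"
  shows "slacks k a \<in> BZ_cone (k - 1) \<longleftrightarrow> a \<in> LR_cone k"
proof -
  have range: "1 \<le> i \<and> i \<le> j \<and> j \<le> k - 1 \<longleftrightarrow> 1 \<le> i \<and> i \<le> j \<and> j < k" for i j
    by auto
  \<comment> \<open>Reindexing j to j+1 brings (P) to the index range of the labeling.\<close>
  have P: "(\<forall>i j. 1 \<le> i \<and> i < j \<and> j \<le> k \<longrightarrow> a i j \<ge> 0)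
      \<longleftrightarrow> (\<forall>i j. 1 \<le> i \<and> i \<le> j \<and> j < k \<longrightarrow> a i (j+1) \<ge> 0)" (is "?L \<longleftrightarrow> ?R")
  proof
    assume R: ?R
    show ?L
    proof (intro allI impI)
      fix i j assume "1 \<le> i \<and> i < j \<and> j \<le> k"
      then have "1 \<le> i \<and> i \<le> j - 1 \<and> j - 1 < k" "j - 1 + 1 = j" by auto
      then show "a i j \<ge> 0" using R by metis
    qed
  qed simp
  have "slacks k a \<in> BZ_cone (k - 1) \<longleftrightarrow>
      (\<forall>i j. 1 \<le> i \<and> i \<le> j \<and> j < k \<longrightarrow>
        (\<Sum>p=0..i-1. a p j) \<ge> (\<Sum>p=0..i. a p (j+1)) \<and> a i (j+1) \<ge> 0 \<and>
        (\<Sum>q=i..j. a i q) \<ge> (\<Sum>q=i+1..j+1. a (i+1) q))"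
    using slacks_in_BZ_space[of k a] unfolding BZ_cone_def slacks_def range
    by (simp del: sum.cl_ivl_Suc)
  also have "\<dots> \<longleftrightarrow> a \<in> LR_cone k"
    using assms unfolding LR_cone_def mem_Collect_eq P by blast
  finally show ?thesis .
qed

text \<open>A BZ type is unchanged when a constant is added to all entries of \<open>lam\<close>;
  \<open>total\<close> fixes that constant. By \<open>tri_space_col_sums\<close> it holds whenever
  some LR triangle has type (lam, mu, nu).\<close>

lemma slacks_in_BZ_of_type_iff:
  assumes a: "a \<in> tri_space0 k" and last: "mu k = 0" "nu k = 0"
    and total: "(\<Sum>i=1..k. lam i) = (\<Sum>i=1..k. mu i) + (\<Sum>i=1..k. nu i)"
  shows "slacks k a \<in> BZ_of_type (k - 1) lam mu nu \<longleftrightarrow> a \<in> LR_of_type k lam mu nu"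
proof -
  define L where "L j = (\<Sum>p=0..j. a p j)" for j
  define N where "N i = (\<Sum>q=i..k. a i q)" for i
  obtain x y z where X: "slacks k a = (x, y, z)" by (cases "slacks k a")
  note xyz = slacks_entries[OF X]
  have tri: "a \<in> tri_space k" and a_last: "a 0 k = 0" "N k = 0"
    using a by (auto simp: tri_space0_def N_def)
  have xy: "x 1 j + y 1 j = a 0 j - a 0 (j+1)" if "j \<in> {1..k-1}" for j
    using that xyz(1,2)[of 1 j] by (cases k) auto
  \<comment> \<open>The (CS) slack at (j, j) misses the diagonal entries of columns j and j+1; the
    (LR) slack supplies both.\<close>
  have xz: "x j j + z j j = L j - L (j+1)" if "j \<in> {1..k-1}" for j
  proof -
    have "(\<Sum>p=0..j. a p j) = (\<Sum>p=0..j-1. a p j) + a j j"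
      using that by (cases j) auto
    then show ?thesis using that xyz(1,3)[of j j] by (cases k) (auto simp: L_def)
  qed
  \<comment> \<open>The (LR) slack at (i, k-1) misses only \<open>a i k\<close> from row i, which is
    the y entry.\<close>
  have yz: "y i (k-1) + z i (k-1) = N i - N (i+1)" if "i \<in> {1..k-1}" for i
  proof -
    have "(\<Sum>q=i..k. a i q) = (\<Sum>q=i..k-1. a i q) + a i k"
      using that by (cases k) auto
    then show ?thesis
      using that xyz(2,3)[of i "k-1"] by (cases k) (auto simp: N_def simp del: sum.cl_ivl_Suc)
  qed
  have mu: "(\<forall>j\<in>{1..k-1}. x 1 j + y 1 j = mu j - mu (j+1)) \<longleftrightarrow> (\<forall>j\<in>{1..k}. mu j = a 0 j)"
    using xy last a_last by (subst eq_iff_differences_eq) auto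
  have nu: "(\<forall>i\<in>{1..k-1}. y i (k-1) + z i (k-1) = nu i - nu (i+1)) \<longleftrightarrow> (\<forall>i\<in>{1..k}. nu i = N i)"
    using yz last a_last by (subst eq_iff_differences_eq) auto
  \<comment> \<open>This equivalence is conditional: once \<open>mu\<close> and \<open>nu\<close>
    match, \<open>total\<close> and double counting equate the sums of \<open>lam\<close> and
    \<open>L\<close>.\<close>
  have lam: "(\<forall>j\<in>{1..k-1}. x j j + z j j = lam j - lam (j+1)) \<longleftrightarrow> (\<forall>j\<in>{1..k}. lam j = L j)"
    if "\<forall>j\<in>{1..k}. mu j = a 0 j" "\<forall>i\<in>{1..k}. nu i = N i"
  proof -
    have "(\<Sum>j=1..k. lam j) = (\<Sum>j=1..k. L j)"
      using total tri_space_col_sums[OF tri] that by (simp add: L_def N_def)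
    then show ?thesis
      using xz by (subst eq_iff_differences_eq_sum_eq) auto
  qed
  have "slacks k a \<in> BZ_of_type (k - 1) lam mu nu \<longleftrightarrow> a \<in> LR_cone k
      \<and> (\<forall>j\<in>{1..k}. mu j = a 0 j) \<and> (\<forall>j\<in>{1..k}. lam j = L j) \<and> (\<forall>i\<in>{1..k}. nu i = N i)"
    using mu nu lam slacks_in_BZ_cone_iff[OF tri]
    unfolding X BZ_of_type_def mem_Collect_eq prod.case by blast
  then show ?thesis
    by (simp add: LR_of_type_def L_def N_def)
qed

section \<open>Injectivity, inclusion of the cones and the bijections\<close>

theorem theorem5p5:
  fixes k :: nat
  assumes "k \<ge> 2"
  shows "Omega k ` BZ_space (k - 1) \<subseteq> tri_space k
    \<and> inj_on (Omega k) (BZ_cone (k - 1))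
    \<and> Omega k ` BZ_cone (k - 1) \<subseteq> LR_cone k
    \<and> (\<forall>lam \<in> dom_weights k. \<forall>mu \<in> dom_weights k. \<forall>nu \<in> dom_weights k.
          mu k = 0 \<and> nu k = 0 \<and> (\<Sum>i=1..k. lam i) = (\<Sum>i=1..k. mu i) + (\<Sum>i=1..k. nu i)
          \<longrightarrow> bij_betw (Omega k) (BZ_of_type (k - 1) lam mu nu) (LR_of_type k lam mu nu))"
proof (intro conjI ballI impI)
  have cone: "BZ_cone (k - 1) \<subseteq> BZ_space (k - 1)"
    by (auto simp: BZ_cone_def)
  have tri: "Omega k X \<in> tri_space k" for X
    using Omega_in_tri_space0 by (auto simp: tri_space0_def)
  then show "Omega k ` BZ_space (k - 1) \<subseteq> tri_space k" by blast
  show "inj_on (Omega k) (BZ_cone (k - 1))"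
    using cone slacks_Omega by (intro inj_on_inverseI[where g = "slacks k"]) blast
  show "Omega k ` BZ_cone (k - 1) \<subseteq> LR_cone k"
  proof
    fix a assume "a \<in> Omega k ` BZ_cone (k - 1)"
    then obtain X where X: "X \<in> BZ_cone (k - 1)" "a = Omega k X" by blast
    \<comment> \<open>The cone criterion applies to \<open>a\<close> because its slack labeling is
      \<open>X\<close> itself.\<close>
    with cone have "slacks k a = X" using slacks_Omega by blast
    then show "a \<in> LR_cone k"
      using X slacks_in_BZ_cone_iff[OF tri[of X]] by simp
  qed
  fix lam mu nu :: "nat \<Rightarrow> real"
  assume asm: "mu k = 0 \<and> nu k = 0 \<and> (\<Sum>i=1..k. lam i) = (\<Sum>i=1..k. mu i) + (\<Sum>i=1..k. nu i)"
  have BZ: "BZ_of_type (k - 1) lam mu nu \<subseteq> BZ_space (k - 1)"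
    using cone by (auto simp: BZ_of_type_def)
  have type_iff: "slacks k a \<in> BZ_of_type (k - 1) lam mu nu \<longleftrightarrow> a \<in> LR_of_type k lam mu nu"
    if "a \<in> tri_space0 k" for a
    using slacks_in_BZ_of_type_iff[OF that] asm by simp
  have LR: "LR_of_type k lam mu nu \<subseteq> tri_space0 k"
  proof
    fix a assume a: "a \<in> LR_of_type k lam mu nu"
    \<comment> \<open>The type conditions at index k turn mu_k = nu_k = 0 into the normalisation of
      \<open>tri_space0\<close>.\<close>
    then have "mu k = a 0 k" "nu k = a k k"
      using assms by (auto simp: LR_of_type_def)
    then show "a \<in> tri_space0 k"
      using a asm by (auto simp: LR_of_type_def LR_cone_def tri_space0_def)
  qed
  show "bij_betw (Omega k) (BZ_of_type (k - 1) lam mu nu) (LR_of_type k lam mu nu)"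
  proof (rule bij_betw_byWitness[where f' = "slacks k"])
    show "\<forall>X\<in>BZ_of_type (k - 1) lam mu nu. slacks k (Omega k X) = X"
      using BZ slacks_Omega by blast
    show "\<forall>a\<in>LR_of_type k lam mu nu. Omega k (slacks k a) = a"
      using LR Omega_slacks by blast
    show "Omega k ` BZ_of_type (k - 1) lam mu nu \<subseteq> LR_of_type k lam mu nu"
    proof
      fix a assume "a \<in> Omega k ` BZ_of_type (k - 1) lam mu nu"
      then obtain X where X: "X \<in> BZ_of_type (k - 1) lam mu nu" "a = Omega k X" by blast
      with BZ have "slacks k a = X" using slacks_Omega by blast
      then show "a \<in> LR_of_type k lam mu nu"
        using X type_iff[OF Omega_in_tri_space0[of k X]] by simp
    qed
    show "slacks k ` LR_of_type k lam mu nu \<subseteq> BZ_of_type (k - 1) lam mu nu"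
      using LR type_iff by blast
  qed
qed

end
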